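(* Let $r \in \mathbb{N}$ with $r \geq 2$, let $E$ and $X$ be absolute neighborhood retracts (ANRs) and let $p\colon E \to X$ be a fibration with path-connected fibers. Let $\Phi\colon E^r_X \times [0,1] \to E^r_X$ be continuous with $$\Phi(u,0)=u, \qquad q_r(\Phi(u,t))= q_r(u) \qquad \text{for all } u \in E^r_X,\ t \in [0,1].$$ Let $F\colon E^r_X \to \mathbb{R}$ be a Lyapunov function for $\Phi_1:= \Phi(\cdot,1)$ which is bounded from below and such that $(\Phi_1,F)$ satisfies condition (D). Then $$\mathsf{TC}_{r,p}(F^\lambda) \leq \sum_{\mu \in (-\infty,\lambda]} \mathsf{TC}_{r,p}(F_\mu \cap \mathrm{Fix}\, \Phi_1) \qquad \text{for all } \lambda \in \mathbb{R}.$$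
   Context: Sublevel and level sets: for $F\colon Y\to\mathbb{R}$ and $\lambda\in\mathbb{R}$ put $F^\lambda=\{y\in Y\mid F(y)\le\lambda\}$ and $F_\lambda=\{y\in Y\mid F(y)=\lambda\}$. For $\varphi\colon Y\to Y$ put $\mathrm{Fix}\,\varphi=\{y\in Y\mid\varphi(y)=y\}$. Lyapunov functions and condition (D): let $Y$ be a topological space and $\varphi\colon Y\to Y$ continuous. A continuous function $F\colon Y\to\mathbb{R}$ is a Lyapunov function for $\varphi$ if $F(\varphi(y))\le F(y)$ for all $y\in Y$. The pair $(\varphi,F)$ satisfies condition (D) if: ($D_1$) $F(\varphi(y))<F(y)$ for all $y\in Y\setminus\mathrm{Fix}\,\varphi$; ($D_2$) if $A\subset Y$ is such that $F$ is bounded on $A$ and $\inf\{F(a)-F(\varphi(a))\mid a\in A\}=0$, then $\overline{A}\cap\mathrm{Fix}\,\varphi\ne\emptyset$. Sequential parametrized subspace complexity: for a fibration $p\colon E\to X$ with path-connected fibers and $r\ge2$ put $E^r_X=\{(u_1,\dots,u_r)\in E^r\mid p(u_1)=\dots=p(u_r)\}$, $q_r\colon E^r_X\to X$, $q_r(u_1,\dots,u_r)=p(u_1)$, and $E^I_X=\{\gamma\in C^0([0,1],E)\mid p(\gamma(t))=p(\gamma(0))\ \forall t\in[0,1]\}$ (compact-open topology). Let $\Pi_r\colon E^I_X\to E^r_X$, $\Pi_r(\gamma)=(\gamma(0),\gamma(\tfrac1{r-1}),\dots,\gamma(\tfrac{r-2}{r-1}),\gamma(1))$. For $A\subset E^r_X$,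 a sequential parametrized motion planner on $A$ is a local section $s\colon A\to E^I_X$ of $\Pi_r$. $\mathsf{TC}_{r,p}(A)$ is the minimal $n$ for which there exist open subsets $U_1,\dots,U_n\subset E^r_X$ with $A\subset\bigcup_{i=1}^nU_i$ such that each $U_i$ admits a continuous sequential parametrized motion planner; if no such $n$ exists, $\mathsf{TC}_{r,p}(A)=\infty$. Convention: $\mathsf{TC}_{r,p}(\emptyset)=0$; the sum has terms in $\mathbb{N}_0\cup\{\infty\}$. An ANR is in particular metrizable. *)

theory Defs
  imports "HOL-Analysis.Analysis"
begin

section \<open>Absolute neighbourhood retracts\<close>

text \<open>
  A metrizable space is an ANR if it is a neighbourhood retract of every metrizable space
  containing it as a closed subspace.  (The constant ANR of HOL-Analysis
  quantifies over subsets of \<^typ>\<open>'a \<times> real\<close> only, which is adequate only for subsets of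
  Euclidean spaces.)  HOL cannot quantify over the type carrying the ambient space \<open>Y\<close>;
  the fixed type \<^typ>\<open>'a \<Rightarrow> real\<close> suffices.  Choose a bounded metric \<open>d\<close> on \<open>X\<close>.  By Kuratowski and
  Wojdyslawski, \<open>x \<mapsto> d x\<close> embeds \<open>X\<close> as a closed subset of its convex hull in the space of bounded
  continuous functions, whose points live in \<^typ>\<open>'a \<Rightarrow> real\<close>.  By Dugundji's extension theorem, a
  neighbourhood retract of this convex set is a neighbourhood retract of every metrizable
  space containing it as a closed subspace.
\<close>

definition ANR_space :: "'a topology \<Rightarrow> bool" where
  "ANR_space X \<longleftrightarrow>
     metrizable_space X \<and>
     (\<forall>(Y :: ('a \<Rightarrow> real) topology) f.
        metrizable_space Y \<and> embedding_map X Y f \<and> closedin Y (f ` topspace X) \<longrightarrow>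
        (\<exists>U. openin Y U \<and> f ` topspace X \<subseteq> U \<and>
             (f ` topspace X) retract_of_space (subtopology Y U)))"


section \<open>Path spaces and fibrations\<close>

abbreviation unit_interval :: "real topology" where
  "unit_interval \<equiv> top_of_set {0..1}"

text \<open>Continuous maps are represented by functions that are undefined outside \<^term>\<open>topspace X\<close>.\<close>

definition compact_open_topology :: "'a topology \<Rightarrow> 'b topology \<Rightarrow> ('a \<Rightarrow> 'b) topology" where
  "compact_open_topology X Y =
     topology_generated_by
       {{f \<in> extensional (topspace X). continuous_map X Y f \<and> f ` K \<subseteq> U} | K U.
          compactin X K \<and> openin Y U}"

definition homotopy_lifting ::
    "'z topology \<Rightarrow> 'e topology \<Rightarrow> 'x topology \<Rightarrow> ('e \<Rightarrow> 'x) \<Rightarrow> bool" where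
  "homotopy_lifting Z E X p \<longleftrightarrow>
     (\<forall>f h. continuous_map Z E f \<and>
            continuous_map (prod_topology Z unit_interval) X h \<and>
            (\<forall>z\<in>topspace Z. h (z, 0) = p (f z)) \<longrightarrow>
        (\<exists>k. continuous_map (prod_topology Z unit_interval) E k \<and>
             (\<forall>z\<in>topspace Z. k (z, 0) = f z) \<and>
             (\<forall>z\<in>topspace Z. \<forall>t\<in>{0..1}. p (k (z, t)) = h (z, t))))"

text \<open>
  A fibration in the sense of Hurewicz.  The test spaces \<open>Z\<close> range over one fixed type, which contains
  the mapping path space of \<open>p\<close>; lemma \<open>fibration_homotopy_lifting\<close> below shows that homotopy
  lifting then holds for test spaces over every type.
\<close>

definition fibration :: "'e topology \<Rightarrow> 'x topology \<Rightarrow> ('e \<Rightarrow> 'x) \<Rightarrow> bool" where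
  "fibration E X p \<longleftrightarrow>
     continuous_map E X p \<and>
     (\<forall>Z :: ('e \<times> (real \<Rightarrow> 'x)) topology. homotopy_lifting Z E X p)"

definition path_connected_fibers :: "'e topology \<Rightarrow> 'x topology \<Rightarrow> ('e \<Rightarrow> 'x) \<Rightarrow> bool" where
  "path_connected_fibers E X p \<longleftrightarrow>
     (\<forall>x\<in>topspace X. path_connected_space (subtopology E {e. p e = x}))"

lemma topspace_compact_open_topology:
  "topspace (compact_open_topology X Y) = {f \<in> extensional (topspace X). continuous_map X Y f}"
proof -
  have "{f \<in> extensional (topspace X). continuous_map X Y f} \<in>
       {{f \<in> extensional (topspace X). continuous_map X Y f \<and> f ` K \<subseteq> U} | K U.
          compactin X K \<and> openin Y U}"
    by (intro CollectI exI[of _ "{}"] exI[of _ "topspace Y"]) auto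
  then show ?thesis
    unfolding compact_open_topology_def topology_generated_by_topspace by blast
qed

lemma openin_compact_open_topology_subbasic:
  assumes "compactin X K" and "openin Y U"
  shows "openin (compact_open_topology X Y)
           {f \<in> extensional (topspace X). continuous_map X Y f \<and> f ` K \<subseteq> U}"
  unfolding compact_open_topology_def
  by (rule topology_generated_by_Basis) (use assms in blast)

lemma continuous_map_curry:
  assumes h: "continuous_map (prod_topology Z T) X h"
  shows "continuous_map Z (compact_open_topology T X) (\<lambda>z. \<lambda>t\<in>topspace T. h (z, t))"
proof -
  let ?g = "\<lambda>z. \<lambda>t\<in>topspace T. h (z, t)"
  have cont: "continuous_map T X (?g z)" if "z \<in> topspace Z" for z
  proof -
    have "continuous_map T X (h \<circ> (\<lambda>t. (z, t)))"
      by (intro continuous_map_compose[OF _ h] continuous_map_pairedI) (use that in auto)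
    then show ?thesis
      by (rule continuous_map_eq) auto
  qed
  show ?thesis
    unfolding compact_open_topology_def
  proof (rule continuous_on_generated_topo)
    fix W
    assume "W \<in> {{f \<in> extensional (topspace T). continuous_map T X f \<and> f ` K \<subseteq> U} | K U.
                   compactin T K \<and> openin X U}"
    then obtain K U where K: "compactin T K" and U: "openin X U"
      and W: "W = {f \<in> extensional (topspace T). continuous_map T X f \<and> f ` K \<subseteq> U}"
      by blast
    have KT: "K \<subseteq> topspace T"
      using K by (rule compactin_subset_topspace)
    let ?P = "{y \<in> topspace (prod_topology Z T). h y \<in> U}"
    have P: "openin (prod_topology Z T) ?P"
      using h U by (rule openin_continuous_map_preimage)
    show "openin Z (?g -` W \<inter> topspace Z)"
    proof (subst openin_subopen, intro ballI)
      fix z assume z: "z \<in> ?g -` W \<inter> topspace Z"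
      then have "{z} \<times> K \<subseteq> ?P"
        using KT by (force simp: W)
      then obtain V1 V2 where V: "openin Z V1" "openin T V2" "{z} \<subseteq> V1" "K \<subseteq> V2" "V1 \<times> V2 \<subseteq> ?P"
        using Wallace_theorem_prod_topology[of Z "{z}" T K ?P] K P z by auto
      have "V1 \<subseteq> ?g -` W \<inter> topspace Z"
        using V KT cont openin_subset[OF V(1)] by (force simp: W)
      then show "\<exists>V. openin Z V \<and> z \<in> V \<and> V \<subseteq> ?g -` W \<inter> topspace Z"
        using V by blast
    qed
  next
    show "?g ` topspace Z \<subseteq>
        \<Union>{{f \<in> extensional (topspace T). continuous_map T X f \<and> f ` K \<subseteq> U} | K U.
          compactin T K \<and> openin X U}"
    proof -
      have "?g ` topspace Z \<subseteq> topspace (compact_open_topology T X)"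
        using cont by (auto simp: topspace_compact_open_topology)
      then show ?thesis
        by (simp only: compact_open_topology_def topology_generated_by_topspace)
    qed
  qed
qed

lemma continuous_map_path_evaluation:
  "continuous_map (prod_topology (compact_open_topology unit_interval X) unit_interval) X
     (\<lambda>(\<gamma>, t). \<gamma> t)"
  (is "continuous_map ?D X ?ev")
  unfolding continuous_map_def
proof (intro conjI allI impI)
  show "?ev \<in> topspace ?D \<rightarrow> topspace X"
    by (auto simp: topspace_compact_open_topology continuous_map_def)
next
  fix U assume U: "openin X U"
  show "openin ?D {x \<in> topspace ?D. ?ev x \<in> U}"
  proof (subst openin_subopen, intro ballI)
    fix y assume y: "y \<in> {x \<in> topspace ?D. ?ev x \<in> U}"
    then obtain \<gamma> t where yeq: "y = (\<gamma>, t)" and t: "t \<in> {0..1}" and \<gamma>U: "\<gamma> t \<in> U"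
      and \<gamma>: "\<gamma> \<in> extensional {0..1}" "continuous_map unit_interval X \<gamma>"
      by (auto simp: topspace_compact_open_topology)
    have "openin unit_interval {s \<in> topspace unit_interval. \<gamma> s \<in> U}"
      using \<gamma>(2) U by (rule openin_continuous_map_preimage)
    then obtain e where e: "e > 0"
      "cball t e \<inter> {0..1} \<subseteq> {s \<in> topspace unit_interval. \<gamma> s \<in> U}"
      using t \<gamma>U unfolding openin_contains_cball by force
    define K where "K = cball t e \<inter> {0..1}"
    let ?W = "{f \<in> extensional (topspace unit_interval).
                 continuous_map unit_interval X f \<and> f ` K \<subseteq> U}"
    have "compactin unit_interval K"
      unfolding compactin_subtopology K_def by (auto simp: compact_Int_closed)
    then have W: "openin (compact_open_topology unit_interval X) ?W"
      using U by (rule openin_compact_open_topology_subbasic)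
    have B: "openin unit_interval ({0..1} \<inter> ball t e)"
      by (simp add: openin_open_Int)
    have "openin ?D (?W \<times> ({0..1} \<inter> ball t e))"
      using W B by (simp add: openin_prod_Times_iff)
    moreover have "y \<in> ?W \<times> ({0..1} \<inter> ball t e)"
      using e t \<gamma> by (auto simp: yeq K_def)
    moreover have "?W \<times> ({0..1} \<inter> ball t e) \<subseteq> {x \<in> topspace ?D. ?ev x \<in> U}"
      by (force simp: topspace_compact_open_topology K_def)
    ultimately show "\<exists>T. openin ?D T \<and> y \<in> T \<and> T \<subseteq> {x \<in> topspace ?D. ?ev x \<in> U}"
      by blast
  qed
qed

lemma fibration_homotopy_lifting:
  fixes Z :: "'z topology" and E :: "'e topology" and X :: "'x topology"
  assumes p: "fibration E X p"
  shows "homotopy_lifting Z E X p"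
  unfolding homotopy_lifting_def
proof (intro allI impI, elim conjE)
  fix f :: "'z \<Rightarrow> 'e" and h
  assume f: "continuous_map Z E f" and h: "continuous_map (prod_topology Z unit_interval) X h"
    and fh: "\<forall>z\<in>topspace Z. h (z, 0) = p (f z)"
  let ?P = "compact_open_topology unit_interval X"
  define N where "N = subtopology (prod_topology E ?P) {(e, \<gamma>). \<gamma> 0 = p e}"
  have ev0: "continuous_map N E fst"
    unfolding N_def by (intro continuous_map_from_subtopology continuous_map_fst)
  have ev: "continuous_map (prod_topology N unit_interval) X (\<lambda>x. snd (fst x) (snd x))"
  proof -
    have "continuous_map (prod_topology N unit_interval) ?P (snd \<circ> fst)"
      unfolding N_def
      by (intro continuous_map_compose[OF continuous_map_fst] continuous_map_from_subtopology
            continuous_map_snd)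
    then have "continuous_map (prod_topology N unit_interval) (prod_topology ?P unit_interval)
        (\<lambda>x. ((snd \<circ> fst) x, snd x))"
      by (intro continuous_map_pairedI continuous_map_snd)
    then have "continuous_map (prod_topology N unit_interval) X
        ((\<lambda>(\<gamma>, t). \<gamma> t) \<circ> (\<lambda>x. ((snd \<circ> fst) x, snd x)))"
      by (rule continuous_map_compose[OF _ continuous_map_path_evaluation])
    then show ?thesis
      by (rule continuous_map_eq) auto
  qed
  have start: "\<forall>y\<in>topspace N. snd (fst (y, 0::real)) (snd (y, 0)) = p (fst y)"
    by (auto simp: N_def)
  have "homotopy_lifting N E X p"
    using p unfolding fibration_def by blast
  note this[unfolded homotopy_lifting_def, THEN spec, THEN spec, THEN mp,
      OF conjI[OF ev0 conjI[OF ev start]]]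
  then obtain k where k: "continuous_map (prod_topology N unit_interval) E k"
    "\<forall>y\<in>topspace N. k (y, 0) = fst y"
    "\<forall>y\<in>topspace N. \<forall>t\<in>{0..1}. p (k (y, t)) = snd y t"
    by auto
  define g where "g z = (f z, \<lambda>t\<in>{0..1}. h (z, t))" for z
  have "continuous_map Z ?P (\<lambda>z. \<lambda>t\<in>{0..1}. h (z, t))"
    using continuous_map_curry[OF h] by simp
  then have g: "continuous_map Z N g"
    unfolding N_def g_def using f fh
    by (intro continuous_map_into_subtopology continuous_map_pairedI) auto
  then have gN: "g z \<in> topspace N" if "z \<in> topspace Z" for z
    using that by (auto simp: continuous_map_def)
  have "continuous_map (prod_topology Z unit_interval) E (k \<circ> (\<lambda>x. (g (fst x), snd x)))"
  proof (intro continuous_map_compose[OF _ k(1)] continuous_map_pairedI continuous_map_snd)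
    show "continuous_map (prod_topology Z unit_interval) N (\<lambda>x. g (fst x))"
      using continuous_map_compose[OF continuous_map_fst g] by (simp add: o_def)
  qed
  moreover have "\<forall>z\<in>topspace Z. (k \<circ> (\<lambda>x. (g (fst x), snd x))) (z, 0) = f z"
    using k(2) gN by (auto simp: g_def)
  moreover have "\<forall>z\<in>topspace Z. \<forall>t\<in>{0..1}.
      p ((k \<circ> (\<lambda>x. (g (fst x), snd x))) (z, t)) = h (z, t)"
    using k(3) gN by (auto simp: g_def)
  ultimately show "\<exists>k. continuous_map (prod_topology Z unit_interval) E k \<and>
             (\<forall>z\<in>topspace Z. k (z, 0) = f z) \<and>
             (\<forall>z\<in>topspace Z. \<forall>t\<in>{0..1}. p (k (z, t)) = h (z, t))"
    by blast
qed


section \<open>Sequential parametrized topological complexity\<close>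

text \<open>An \<open>r\<close>-tuple \<open>(u\<^sub>1, \<dots>, u\<^sub>r)\<close> is a function on \<^term>\<open>{1..r}\<close>, undefined elsewhere.\<close>

definition fiber_power :: "nat \<Rightarrow> 'e topology \<Rightarrow> ('e \<Rightarrow> 'x) \<Rightarrow> (nat \<Rightarrow> 'e) topology" where
  "fiber_power r E p =
     subtopology (product_topology (\<lambda>_. E) {1..r})
       {u. \<forall>i\<in>{1..r}. \<forall>j\<in>{1..r}. p (u i) = p (u j)}"

definition fiber_power_proj :: "('e \<Rightarrow> 'x) \<Rightarrow> (nat \<Rightarrow> 'e) \<Rightarrow> 'x" where
  "fiber_power_proj p u = p (u 1)"

definition vertical_paths :: "'e topology \<Rightarrow> ('e \<Rightarrow> 'x) \<Rightarrow> (real \<Rightarrow> 'e) topology" where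
  "vertical_paths E p =
     subtopology (compact_open_topology unit_interval E) {\<gamma>. \<forall>t\<in>{0..1}. p (\<gamma> t) = p (\<gamma> 0)}"

definition path_eval :: "nat \<Rightarrow> (real \<Rightarrow> 'e) \<Rightarrow> nat \<Rightarrow> 'e" where
  "path_eval r \<gamma> = (\<lambda>i\<in>{1..r}. \<gamma> ((real i - 1) / (real r - 1)))"

definition seq_motion_planner ::
    "nat \<Rightarrow> 'e topology \<Rightarrow> ('e \<Rightarrow> 'x) \<Rightarrow> (nat \<Rightarrow> 'e) set \<Rightarrow> ((nat \<Rightarrow> 'e) \<Rightarrow> real \<Rightarrow> 'e) \<Rightarrow> bool" where
  "seq_motion_planner r E p A s \<longleftrightarrow>
     (\<forall>u\<in>A. s u \<in> topspace (vertical_paths E p) \<and> path_eval r (s u) = u)"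

text \<open>The infimum of the empty set of \<^typ>\<open>enat\<close> is \<open>\<infinity>\<close>.\<close>

definition seq_TC ::
    "nat \<Rightarrow> 'e topology \<Rightarrow> ('e \<Rightarrow> 'x) \<Rightarrow> (nat \<Rightarrow> 'e) set \<Rightarrow> enat" where
  "seq_TC r E p A =
     Inf {enat n | n. \<exists>U. A \<subseteq> (\<Union>i\<in>{1..n}. U i) \<and>
            (\<forall>i\<in>{1..n}. openin (fiber_power r E p) (U i) \<and>
               (\<exists>s. seq_motion_planner r E p (U i) s \<and>
                    continuous_map (subtopology (fiber_power r E p) (U i)) (vertical_paths E p) s))}"


section \<open>Lyapunov functions and condition (D)\<close>

definition fixed_points :: "'a topology \<Rightarrow> ('a \<Rightarrow> 'a) \<Rightarrow> 'a set" where
  "fixed_points Y \<phi> = {y \<in> topspace Y. \<phi> y = y}"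

definition sublevel :: "'a topology \<Rightarrow> ('a \<Rightarrow> real) \<Rightarrow> real \<Rightarrow> 'a set" where
  "sublevel Y F c = {y \<in> topspace Y. F y \<le> c}"

definition level :: "'a topology \<Rightarrow> ('a \<Rightarrow> real) \<Rightarrow> real \<Rightarrow> 'a set" where
  "level Y F c = {y \<in> topspace Y. F y = c}"

definition lyapunov_function :: "'a topology \<Rightarrow> ('a \<Rightarrow> 'a) \<Rightarrow> ('a \<Rightarrow> real) \<Rightarrow> bool" where
  "lyapunov_function Y \<phi> F \<longleftrightarrow>
     continuous_map Y euclideanreal F \<and> (\<forall>y\<in>topspace Y. F (\<phi> y) \<le> F y)"

text \<open>
  The condition \<^term>\<open>A \<noteq> {}\<close> is needed because \<^term>\<open>Inf {} :: real\<close> is not \<open>+\<infinity>\<close> in HOL.  By the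
  first conjunct, the infimum is taken over a set bounded below by \<open>0\<close>.
\<close>

definition condition_D :: "'a topology \<Rightarrow> ('a \<Rightarrow> 'a) \<Rightarrow> ('a \<Rightarrow> real) \<Rightarrow> bool" where
  "condition_D Y \<phi> F \<longleftrightarrow>
     (\<forall>y\<in>topspace Y - fixed_points Y \<phi>. F (\<phi> y) < F y) \<and>
     (\<forall>A. A \<subseteq> topspace Y \<and> A \<noteq> {} \<and> bounded (F ` A) \<and> (INF a\<in>A. F a - F (\<phi> a)) = 0 \<longrightarrow>
          (Y closure_of A) \<inter> fixed_points Y \<phi> \<noteq> {})"

end

theory Submission
  imports Defs
begin

text \<open>
  The argument is Lusternik--Schnirelmann theory.  \<open>TC\<close> is monotone, subadditive, attained on an open
  neighbourhood, and does not increase under preimages of \<open>\<Phi>\<^sub>1\<close>: a planner at \<open>\<Phi>\<^sub>1 u\<close> is turned into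
  one at \<open>u\<close> by inserting excursions along the vertical paths \<open>t \<mapsto> \<Phi> (u, t) k\<close>.  By condition (D), on
  a closed set without fixed points on which \<open>F\<close> is bounded, \<open>\<Phi>\<^sub>1\<close> lowers \<open>F\<close> by at
  least some \<open>\<delta> > 0\<close>.  So the index of a sublevel set does not change across a band without critical
  levels, and at an isolated critical level \<open>c\<close> with a neighbourhood \<open>U\<close> of its fixed points one step
  of \<open>\<Phi>\<^sub>1\<close> sends \<open>F\<^bsup>c+\<epsilon>\<^esup> - U\<close> into \<open>F\<^bsup>c-\<epsilon>\<^esup>\<close>.
\<close>

section \<open>Lusternik--Schnirelmann theory under condition (D)\<close>

text \<open>The five axioms on \<open>\<nu>\<close> isolate what the sublevel estimate uses of the
  complexity. Homotopy invariance enters only as \<open>index_preimage\<close>, so a single map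
  \<open>\<phi>\<close> replaces a flow.\<close>

locale lusternik_schnirelmann =
  fixes Y :: "'a topology" and \<phi> :: "'a \<Rightarrow> 'a" and F :: "'a \<Rightarrow> real" and \<nu> :: "'a set \<Rightarrow> enat"
  assumes continuous: "continuous_map Y Y \<phi>"
    and lyapunov: "lyapunov_function Y \<phi> F"
    and bounded_below: "bdd_below (F ` topspace Y)"
    and condition_D: "condition_D Y \<phi> F"
    and index_eq_0: "\<nu> A = 0 \<longleftrightarrow> A = {}"
    and index_mono: "A \<subseteq> B \<Longrightarrow> \<nu> A \<le> \<nu> B"
    and index_Un: "\<nu> (A \<union> B) \<le> \<nu> A + \<nu> B"
    and index_preimage: "\<nu> {y \<in> topspace Y. \<phi> y \<in> A} \<le> \<nu> A"
    and index_neighbourhood: "A \<subseteq> topspace Y \<Longrightarrow> \<exists>U. openin Y U \<and> A \<subseteq> U \<and> \<nu> U \<le> \<nu> A"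
begin

section \<open>Critical sets and decrease of the Lyapunov function\<close>

definition critical :: "real \<Rightarrow> 'a set" where
  "critical c = level Y F c \<inter> fixed_points Y \<phi>"

lemma continuous_F: "continuous_map Y euclideanreal F"
  and F_le: "y \<in> topspace Y \<Longrightarrow> F (\<phi> y) \<le> F y"
  using lyapunov by (auto simp: lyapunov_function_def)

lemma map_in_topspace: "y \<in> topspace Y \<Longrightarrow> \<phi> y \<in> topspace Y"
  using continuous by (auto simp: continuous_map_def)

lemma map_sublevel: "y \<in> sublevel Y F c \<Longrightarrow> \<phi> y \<in> sublevel Y F c"
  using F_le map_in_topspace by (force simp: sublevel_def)

lemma closedin_band: "closedin Y {y \<in> topspace Y. a \<le> F y \<and> F y \<le> b}"
proof -
  have "closedin Y {y \<in> topspace Y. F y \<in> {a..b}}"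
    by (rule closedin_continuous_map_preimage[OF continuous_F]) auto
  then show ?thesis
    by simp
qed

text \<open>The infimum of \<open>F a - F (\<phi> a)\<close> over \<open>A\<close> serves as
  \<open>\<delta>\<close>: it is nonnegative since \<open>F\<close> is Lyapunov, and were it 0, the
  second part of condition (D) would put a fixed point into the closure of \<open>A\<close>, which
  is \<open>A\<close> itself.\<close>

lemma uniform_decrease:
  assumes A: "closedin Y A" "A \<inter> fixed_points Y \<phi> = {}" and bdd: "bdd_above (F ` A)"
  obtains \<delta> where "\<delta> > 0" "\<And>y. y \<in> A \<Longrightarrow> F (\<phi> y) \<le> F y - \<delta>"
proof (cases "A = {}")
  case True
  then show ?thesis
    using that[of 1] by auto
next
  case False
  let ?m = "INF a\<in>A. F a - F (\<phi> a)"
  have sub: "A \<subseteq> topspace Y"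
    using A(1) by (rule closedin_subset)
  \<comment> \<open>The lower bound is inherited from the global one of \<open>F\<close>.\<close>
  obtain l u where "F ` A \<subseteq> {l..u}"
    using bdd bdd_below_mono[OF bounded_below image_mono[OF sub]]
    unfolding bdd_above_def bdd_below_def by (metis atLeastAtMost_iff subsetI)
  then have "bounded (F ` A)"
    using bounded_closed_interval bounded_subset by blast
  moreover have "Y closure_of A = A"
    using A(1) by (simp add: closure_of_closedin)
  ultimately have "?m \<noteq> 0"
    using condition_D False sub A(2) unfolding condition_D_def by metis
  moreover have nonneg: "F a - F (\<phi> a) \<ge> 0" if "a \<in> A" for a
    using F_le sub that by force
  then have "?m \<ge> 0"
    by (rule cINF_greatest[OF False])
  moreover have "F (\<phi> y) \<le> F y - ?m" if "y \<in> A" for y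
  proof -
    have "?m \<le> F y - F (\<phi> y)"
      by (rule cINF_lower) (use that nonneg in \<open>auto intro!: bdd_belowI[of _ 0]\<close>)
    then show ?thesis
      by simp
  qed
  ultimately show ?thesis
    by (intro that[of ?m]) auto
qed

section \<open>Change of the index across a band of levels\<close>

lemma index_sublevel_step:
  assumes "\<And>y. y \<in> sublevel Y F b \<Longrightarrow> \<phi> y \<in> A"
  shows "\<nu> (sublevel Y F b) \<le> \<nu> A"
proof -
  have "\<nu> (sublevel Y F b) \<le> \<nu> {y \<in> topspace Y. \<phi> y \<in> A}"
    by (rule index_mono) (use assms in \<open>auto simp: sublevel_def\<close>)
  also have "\<dots> \<le> \<nu> A"
    by (rule index_preimage)
  finally show ?thesis .
qed

text \<open>The band has a uniform decrease \<open>\<delta>\<close>, so \<open>\<phi>\<close> maps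
  the sublevel set at \<open>a + (n + 1) * \<delta>\<close>, cut off at \<open>b\<close>, into the
  one at \<open>a + n * \<delta>\<close>. Finitely many such steps climb from \<open>a\<close> to
  \<open>b\<close> without raising the index.\<close>

lemma index_sublevel_regular:
  assumes "a \<le> b" and reg: "\<And>\<mu>. a \<le> \<mu> \<Longrightarrow> \<mu> \<le> b \<Longrightarrow> critical \<mu> = {}"
  shows "\<nu> (sublevel Y F b) \<le> \<nu> (sublevel Y F a)"
proof -
  let ?A = "{y \<in> topspace Y. a \<le> F y \<and> F y \<le> b}"
  have "?A \<inter> fixed_points Y \<phi> = {}"
    using reg by (force simp: critical_def level_def)
  moreover have "bdd_above (F ` ?A)"
    by (auto intro!: bdd_aboveI[of _ b])
  ultimately obtain \<delta> where \<delta>: "\<delta> > 0" "\<And>y. y \<in> ?A \<Longrightarrow> F (\<phi> y) \<le> F y - \<delta>"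
    by (rule uniform_decrease[OF closedin_band]) meson
  have "\<nu> (sublevel Y F (min b (a + real n * \<delta>))) \<le> \<nu> (sublevel Y F a)" for n
  proof (induction n)
    case 0
    show ?case
      by (rule index_mono) (auto simp: sublevel_def)
  next
    case (Suc n)
    have "\<nu> (sublevel Y F (min b (a + real (Suc n) * \<delta>)))
        \<le> \<nu> (sublevel Y F (min b (a + real n * \<delta>)))"
    proof (rule index_sublevel_step)
      fix y assume y: "y \<in> sublevel Y F (min b (a + real (Suc n) * \<delta>))"
      show "\<phi> y \<in> sublevel Y F (min b (a + real n * \<delta>))"
      proof (cases "a \<le> F y")
        case True
        then have "F (\<phi> y) \<le> F y - \<delta>"
          using \<delta>(2) y by (auto simp: sublevel_def)
        then show ?thesis
          using y \<delta>(1) map_in_topspace by (auto simp: sublevel_def algebra_simps)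
      next
        \<comment> \<open>Below \<open>a\<close> no decrease by \<open>\<delta>\<close> is known,
          but such points already lie in the lower sublevel set, which \<open>\<phi>\<close>
          preserves.\<close>
        case False
        then have "F y \<le> min b (a + real n * \<delta>)"
          using \<delta>(1) \<open>a \<le> b\<close> by (smt (verit) mult_nonneg_nonneg of_nat_0_le_iff)
        then show ?thesis
          using y by (intro map_sublevel) (auto simp: sublevel_def)
      qed
    qed
    with Suc show ?case
      by (rule order_trans[rotated])
  qed
  moreover obtain n where "b \<le> a + real n * \<delta>"
    using reals_Archimedean3[OF \<delta>(1), rule_format, of "b - a"] by (smt (verit))
  ultimately show ?thesis
    by (metis min.absorb1)
qed

text \<open>Removing a neighbourhood \<open>U\<close> of the critical set leaves a band with uniform
  decrease, so \<open>U\<close> and one preimage under \<open>\<phi>\<close> cover a sublevel set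
  slightly above \<open>c\<close>. How far below \<open>c\<close> the level \<open>a'\<close> lies
  depends on \<open>U\<close>, so the lemma produces it.\<close>

lemma index_sublevel_critical:
  assumes "a < c" "c \<le> b"
    and reg: "\<And>\<mu>. a \<le> \<mu> \<Longrightarrow> \<mu> \<le> b \<Longrightarrow> \<mu> \<noteq> c \<Longrightarrow> critical \<mu> = {}"
  obtains a' where "a \<le> a'" "a' < c"
    "\<nu> (sublevel Y F b) \<le> \<nu> (critical c) + \<nu> (sublevel Y F a')"
proof -
  have "critical c \<subseteq> topspace Y"
    by (auto simp: critical_def level_def)
  then obtain U where U: "openin Y U" "critical c \<subseteq> U" "\<nu> U \<le> \<nu> (critical c)"
    using index_neighbourhood by meson
  let ?A = "{y \<in> topspace Y. a \<le> F y \<and> F y \<le> b} - U"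
  have "closedin Y ?A"
    using closedin_band U(1) by (rule closedin_diff)
  moreover have "?A \<inter> fixed_points Y \<phi> = {}"
  proof -
    have "y \<in> U" if "y \<in> topspace Y" "a \<le> F y" "F y \<le> b" "y \<in> fixed_points Y \<phi>" for y
    proof -
      have "y \<in> critical (F y)"
        using that by (simp add: critical_def level_def)
      then show ?thesis
        using reg[of "F y"] that U(2) by (cases "F y = c") auto
    qed
    then show ?thesis
      by blast
  qed
  moreover have "bdd_above (F ` ?A)"
    by (auto intro!: bdd_aboveI[of _ b])
  ultimately obtain \<delta> where \<delta>: "\<delta> > 0" "\<And>y. y \<in> ?A \<Longrightarrow> F (\<phi> y) \<le> F y - \<delta>"
    by (rule uniform_decrease) meson
  \<comment> \<open>The first bound keeps \<open>c - \<epsilon>\<close> in the band; the second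
    makes a drop by \<open>\<delta>\<close> lead from \<open>c + \<epsilon>\<close> to at most
    \<open>c - \<epsilon>\<close>.\<close>
  define \<epsilon> where "\<epsilon> = min (c - a) (\<delta> / 2)"
  have \<epsilon>: "\<epsilon> > 0" "a \<le> c - \<epsilon>" "2 * \<epsilon> \<le> \<delta>"
    using \<delta>(1) \<open>a < c\<close> by (auto simp: \<epsilon>_def min_def)
  let ?V = "{y \<in> topspace Y. \<phi> y \<in> sublevel Y F (c - \<epsilon>)}"
  have "sublevel Y F (min b (c + \<epsilon>)) \<subseteq> U \<union> ?V"
  proof
    fix y assume y: "y \<in> sublevel Y F (min b (c + \<epsilon>))"
    show "y \<in> U \<union> ?V"
    proof (cases "y \<in> U \<or> F y < c - \<epsilon>")
      case True
      then show ?thesis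
        using y map_sublevel[of y "c - \<epsilon>"] by (auto simp: sublevel_def)
    next
      case False
      then have "F (\<phi> y) \<le> F y - \<delta>"
        using \<delta>(2) y \<epsilon>(2) by (auto simp: sublevel_def)
      then show ?thesis
        using y \<epsilon> map_in_topspace by (auto simp: sublevel_def)
    qed
  qed
  then have "\<nu> (sublevel Y F (min b (c + \<epsilon>))) \<le> \<nu> U + \<nu> ?V"
    using index_mono index_Un order_trans by blast
  also have "\<dots> \<le> \<nu> (critical c) + \<nu> (sublevel Y F (c - \<epsilon>))"
    by (intro add_mono U(3) index_preimage)
  finally have "\<nu> (sublevel Y F (min b (c + \<epsilon>))) \<le> \<nu> (critical c) + \<nu> (sublevel Y F (c - \<epsilon>))" .
  \<comment> \<open>If \<open>c + \<epsilon> < b\<close>, the band from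
    \<open>c + \<epsilon>\<close> to \<open>b\<close> lies strictly above \<open>c\<close> and is
    regular.\<close>
  moreover have "\<nu> (sublevel Y F b) \<le> \<nu> (sublevel Y F (min b (c + \<epsilon>)))"
  proof (cases "b \<le> c + \<epsilon>")
    case False
    then show ?thesis
      using \<epsilon>(1) \<open>a < c\<close> by (intro index_sublevel_regular reg) auto
  qed (simp add: min_def)
  ultimately have "\<nu> (sublevel Y F b) \<le> \<nu> (critical c) + \<nu> (sublevel Y F (c - \<epsilon>))"
    by (rule order_trans[rotated])
  with \<epsilon> show ?thesis
    by (intro that[of "c - \<epsilon>"]) auto
qed

section \<open>Summation over the critical levels\<close>

text \<open>Induction on the number of critical levels up to \<open>c\<close>: passing below the
  largest one, \<open>d\<close>, costs its summand and leaves exactly the others.\<close>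

lemma index_sublevel_le_sum:
  assumes "finite {\<mu>. \<mu> \<le> c \<and> critical \<mu> \<noteq> {}}" (is "finite (?C c)")
  shows "\<nu> (sublevel Y F c) \<le> (\<Sum>\<mu> | \<mu> \<le> c \<and> critical \<mu> \<noteq> {}. \<nu> (critical \<mu>))"
  using assms
proof (induction "card (?C c)" arbitrary: c rule: less_induct)
  case less
  obtain m where m: "\<And>y. y \<in> topspace Y \<Longrightarrow> m \<le> F y"
    using bounded_below by (auto simp: bdd_below_def)
  show ?case
  proof (cases "?C c = {}")
    case True
    \<comment> \<open>Without critical levels one can descend below the lower bound \<open>m\<close>
      of \<open>F\<close>, where the sublevel set is empty.\<close>
    have "\<nu> (sublevel Y F c) \<le> \<nu> (sublevel Y F (min c (m - 1)))"
      using True by (intro index_sublevel_regular) auto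
    also have "sublevel Y F (min c (m - 1)) = {}"
      using m by (force simp: sublevel_def)
    finally show ?thesis
      using index_eq_0[of "{}"] by simp
  next
    case False
    define d where "d = Max (?C c)"
    have d: "d \<in> ?C c" "\<And>\<mu>. \<mu> \<in> ?C c \<Longrightarrow> \<mu> \<le> d"
      using less.prems False Max_in[of "?C c"] by (auto simp: d_def)
    \<comment> \<open>The midpoint between \<open>d\<close> and the next lower critical level, or
      \<open>d - 1\<close> if there is none, so that \<open>d\<close> is the only critical level in
      the band from \<open>a\<close> to \<open>c\<close>.\<close>
    define a where "a = (if ?C c - {d} = {} then d - 1 else (Max (?C c - {d}) + d) / 2)"
    have fin: "finite (?C c - {d})"
      using less.prems by simp
    have lt: "\<mu> < d" if "\<mu> \<in> ?C c - {d}" for \<mu>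
      using d(2)[of \<mu>] that by auto
    have a: "a < d" "\<And>\<mu>. \<mu> \<in> ?C c - {d} \<Longrightarrow> \<mu> < a"
    proof -
      show "a < d"
        using Max_in[OF fin] lt by (auto simp: a_def)
      fix \<mu> assume "\<mu> \<in> ?C c - {d}"
      then have "\<mu> \<le> Max (?C c - {d})" "?C c - {d} \<noteq> {}" "Max (?C c - {d}) < d"
        using Max_ge[OF fin] Max_in[OF fin] lt by blast+
      then show "\<mu> < a"
        unfolding a_def by (simp only: if_False) simp
    qed
    obtain a' where a': "a \<le> a'" "a' < d"
      "\<nu> (sublevel Y F c) \<le> \<nu> (critical d) + \<nu> (sublevel Y F a')"
      by (rule index_sublevel_critical[of a d c]) (use a d(1) in force)+
    have C: "?C a' = ?C c - {d}"
      using a a' d(1) by force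
    then have "card (?C a') < card (?C c)"
      unfolding C using less.prems d(1) by (intro card_Diff1_less)
    then have "\<nu> (sublevel Y F a') \<le> sum (\<lambda>\<mu>. \<nu> (critical \<mu>)) (?C c - {d})"
      using less.hyps[of a'] less.prems C by simp
    then show ?thesis
      using a'(3) sum.remove[OF less.prems d(1), of "\<lambda>\<mu>. \<nu> (critical \<mu>)"]
      by (metis (no_types, lifting) add_left_mono order_trans)
  qed
qed

text \<open>Only critical levels contribute to the sum. If there are infinitely many, each
  contributes at least 1 and the right-hand side is infinite.\<close>

theorem index_sublevel_le_infsum:
  "\<nu> (sublevel Y F c) \<le> (\<Sum>\<^sub>\<infinity>\<mu>\<in>{..c}. \<nu> (level Y F \<mu> \<inter> fixed_points Y \<phi>))"
proof -
  let ?C = "{\<mu>. \<mu> \<le> c \<and> critical \<mu> \<noteq> {}}"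
  have eq: "(\<Sum>\<^sub>\<infinity>\<mu>\<in>{..c}. \<nu> (critical \<mu>)) = (\<Sum>\<^sub>\<infinity>\<mu>\<in>?C. \<nu> (critical \<mu>))"
    by (rule infsum_cong_neutral) (auto simp: index_eq_0)
  have "\<nu> (sublevel Y F c) \<le> (\<Sum>\<^sub>\<infinity>\<mu>\<in>?C. \<nu> (critical \<mu>))"
  proof (cases "finite ?C")
    case True
    then show ?thesis
      using index_sublevel_le_sum by simp
  next
    case False
    have "1 \<le> \<nu> (critical \<mu>)" if "\<mu> \<in> ?C" for \<mu>
      using that index_eq_0[of "critical \<mu>"] by (simp add: one_eSuc ileI1)
    then have "(\<Sum>\<^sub>\<infinity>\<mu>\<in>?C. \<nu> (critical \<mu>)) = \<infinity>"
      using False by (intro infsum_superconst_infinite_enat[where b = 1]) auto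
    then show ?thesis
      by simp
  qed
  then show ?thesis
    unfolding eq[symmetric] by (simp add: critical_def)
qed

end

section \<open>Complexity and preimages under vertical deformations\<close>

definition planner_domain :: "nat \<Rightarrow> 'e topology \<Rightarrow> ('e \<Rightarrow> 'x) \<Rightarrow> (nat \<Rightarrow> 'e) set \<Rightarrow> bool" where
  "planner_domain r E p U \<longleftrightarrow>
     openin (fiber_power r E p) U \<and>
     (\<exists>s. seq_motion_planner r E p U s \<and>
          continuous_map (subtopology (fiber_power r E p) U) (vertical_paths E p) s)"

lemma seq_TC_le:
  assumes "A \<subseteq> (\<Union>i\<in>{1..n}. U i)" and "\<And>i. i \<in> {1..n} \<Longrightarrow> planner_domain r E p (U i)"
  shows "seq_TC r E p A \<le> enat n"
  unfolding seq_TC_def using assms by (intro Inf_lower) (auto simp: planner_domain_def)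

text \<open>The infimum is attained: its finiteness excludes the empty set, and \<open>enat\<close>
  is well-ordered.\<close>

lemma seq_TC_cover:
  assumes "seq_TC r E p A = enat n"
  obtains U where "A \<subseteq> (\<Union>i\<in>{1..n}. U i)" and "\<And>i. i \<in> {1..n} \<Longrightarrow> planner_domain r E p (U i)"
proof -
  let ?S = "{enat n | n. \<exists>U. A \<subseteq> (\<Union>i\<in>{1..n}. U i) \<and> (\<forall>i\<in>{1..n}. planner_domain r E p (U i))}"
  have "Inf ?S = enat n"
    using assms by (simp add: seq_TC_def planner_domain_def)
  moreover from this have "?S \<noteq> {}"
    by (metis Inf_empty enat.distinct(1) top_enat_def)
  ultimately have "enat n \<in> ?S"
    by (metis (no_types, lifting) LeastI Inf_enat_def ex_in_conv)
  then show ?thesis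
    using that by auto
qed

text \<open>For \<open>n = 0\<close> the index range \<open>{1..0}\<close> is empty, so the union of
  the cover is empty.\<close>

lemma seq_TC_eq_0_iff: "seq_TC r E p A = 0 \<longleftrightarrow> A = {}"
proof
  assume "seq_TC r E p A = 0"
  then show "A = {}"
    using seq_TC_cover[of r E p A 0] by (auto simp: zero_enat_def)
next
  assume "A = {}"
  then show "seq_TC r E p A = 0"
    using seq_TC_le[where A = A and n = 0] by (simp add: zero_enat_def[symmetric])
qed

lemma seq_TC_mono:
  assumes "A \<subseteq> B"
  shows "seq_TC r E p A \<le> seq_TC r E p B"
proof (cases "seq_TC r E p B")
  case (enat n)
  then obtain U where "B \<subseteq> (\<Union>i\<in>{1..n}. U i)" "\<And>i. i \<in> {1..n} \<Longrightarrow> planner_domain r E p (U i)"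
    using seq_TC_cover by metis
  then show ?thesis
    unfolding enat using assms by (intro seq_TC_le) auto
qed simp

lemma seq_TC_Un: "seq_TC r E p (A \<union> B) \<le> seq_TC r E p A + seq_TC r E p B"
proof (cases "seq_TC r E p A" "seq_TC r E p B" rule: enat.exhaust[case_product enat.exhaust])
  case (enat_enat m n)
  obtain U where U: "A \<subseteq> (\<Union>i\<in>{1..m}. U i)" "\<And>i. i \<in> {1..m} \<Longrightarrow> planner_domain r E p (U i)"
    using seq_TC_cover enat_enat(1) by metis
  obtain V where V: "B \<subseteq> (\<Union>i\<in>{1..n}. V i)" "\<And>i. i \<in> {1..n} \<Longrightarrow> planner_domain r E p (V i)"
    using seq_TC_cover enat_enat(2) by metis
  \<comment> \<open>Concatenation of the two covers, the second one shifted by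
    \<open>m\<close>.\<close>
  define W where "W i = (if i \<le> m then U i else V (i - m))" for i
  have "seq_TC r E p (A \<union> B) \<le> enat (m + n)"
  proof (rule seq_TC_le)
    have "U i \<subseteq> (\<Union>i\<in>{1..m + n}. W i)" if "i \<in> {1..m}" for i
      using that by (force simp: W_def)
    moreover have "V i \<subseteq> (\<Union>i\<in>{1..m + n}. W i)" if "i \<in> {1..n}" for i
      using that by (intro SUP_upper2[of "m + i"]) (auto simp: W_def)
    ultimately show "A \<union> B \<subseteq> (\<Union>i\<in>{1..m + n}. W i)"
      by (intro Un_least order_trans[OF U(1)] order_trans[OF V(1)] UN_least)
    show "planner_domain r E p (W i)" if "i \<in> {1..m + n}" for i
    proof (cases "i \<le> m")
      case True
      then show ?thesis
        using that U(2) by (simp add: W_def)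
    next
      case False
      then have "i - m \<in> {1..n}"
        using that by auto
      then show ?thesis
        using False V(2) by (simp add: W_def)
    qed
  qed
  then show ?thesis
    by (simp add: enat_enat)
qed simp_all

text \<open>The union of an optimal cover is open and is covered by the same sets; for infinite
  complexity the whole space serves.\<close>

lemma seq_TC_neighbourhood:
  assumes "A \<subseteq> topspace (fiber_power r E p)"
  obtains U where "openin (fiber_power r E p) U" "A \<subseteq> U" "seq_TC r E p U \<le> seq_TC r E p A"
proof (cases "seq_TC r E p A")
  case (enat n)
  obtain U where U: "A \<subseteq> (\<Union>i\<in>{1..n}. U i)" "\<And>i. i \<in> {1..n} \<Longrightarrow> planner_domain r E p (U i)"
    using seq_TC_cover[OF enat] by metis
  show ?thesis
  proof (rule that)
    show "openin (fiber_power r E p) (\<Union>i\<in>{1..n}. U i)"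
      using U(2) by (auto simp: planner_domain_def)
    show "seq_TC r E p (\<Union>i\<in>{1..n}. U i) \<le> seq_TC r E p A"
      unfolding enat using U(2) by (intro seq_TC_le) auto
  qed (rule U)
next
  case infinity
  then show ?thesis
    using that[of "topspace (fiber_power r E p)"] assms by simp
qed

section \<open>Pulling back a planner along a vertical deformation\<close>

text \<open>A path run with \<open>\<sigma>\<close> rests at every node for a while, which makes
  room for an excursion there.\<close>

lemma step_reparametrization:
  fixes r :: nat
  assumes r: "r \<ge> 2"
  obtains \<sigma> :: "real \<Rightarrow> real" where "continuous_on {0..1} \<sigma>" "\<sigma> ` {0..1} \<subseteq> {0..1}"
    "\<forall>k\<in>{1..r}. \<forall>t. \<bar>(real r - 1) * t - (real k - 1)\<bar> \<le> 1/3 \<longrightarrow>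
       \<sigma> t = (real k - 1) / (real r - 1)"
proof
  \<comment> \<open>A ramp from 0 at \<open>x = 1/3\<close> to 1 at \<open>x = 2/3\<close>. Shifted
    copies add up to a staircase: near node \<open>k\<close> the first \<open>k - 1\<close> ramps
    are complete and the others have not begun.\<close>
  define c :: "real \<Rightarrow> real" where "c x = min 1 (max 0 (3 * x - 1))" for x
  define \<sigma> where "\<sigma> t = (\<Sum>j<r - 1. c ((real r - 1) * t - real j)) / (real r - 1)" for t
  have r1: "real r - 1 > 0"
    using r by simp
  show "continuous_on {0..1} \<sigma>"
    unfolding \<sigma>_def c_def using r1 by (intro continuous_intros) auto
  have "0 \<le> (\<Sum>j<r - 1. c ((real r - 1) * t - real j))" for t
    by (intro sum_nonneg) (auto simp: c_def)
  moreover have "(\<Sum>j<r - 1. c ((real r - 1) * t - real j)) \<le> real r - 1" for t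
    using sum_bounded_above[of "{..<r - 1}" "\<lambda>j. c ((real r - 1) * t - real j)" 1] r
    by (auto simp: c_def of_nat_diff)
  ultimately show "\<sigma> ` {0..1} \<subseteq> {0..1}"
    using r1 by (auto simp: \<sigma>_def)
  show "\<forall>k\<in>{1..r}. \<forall>t. \<bar>(real r - 1) * t - (real k - 1)\<bar> \<le> 1/3 \<longrightarrow>
       \<sigma> t = (real k - 1) / (real r - 1)"
  proof (intro ballI allI impI)
    fix k t assume k: "k \<in> {1..r}" and t: "\<bar>(real r - 1) * t - (real k - 1)\<bar> \<le> 1/3"
    define x where "x = (real r - 1) * t"
    have x: "x - (real k - 1) \<le> 1/3" "- (1/3) \<le> x - (real k - 1)"
      using t unfolding x_def abs_le_iff by linarith+
    have "c (x - real j) = (if j < k - 1 then 1 else 0)" for j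
    proof (cases "j < k - 1")
      case True
      then have "real j + 1 \<le> real k - 1"
        by linarith
      then have "3 * (x - real j) - 1 \<ge> 1"
        using x by (simp add: field_simps)
      then show ?thesis
        using True by (simp add: c_def)
    next
      case False
      then have "real k - 1 \<le> real j"
        by linarith
      then have "3 * (x - real j) - 1 \<le> 0"
        using x by (simp add: field_simps)
      then show ?thesis
        using False by (simp add: c_def)
    qed
    then have "(\<Sum>j<r - 1. c ((real r - 1) * t - real j)) = (\<Sum>j<r - 1. if j < k - 1 then 1 else 0)"
      by (simp add: x_def)
    also have "\<dots> = (\<Sum>j<k - 1. 1)"
      using k by (intro sum.mono_neutral_cong_right) auto
    finally show "\<sigma> t = (real k - 1) / (real r - 1)"
      using k by (simp add: \<sigma>_def of_nat_diff)
  qed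
qed

text \<open>The new path follows the planner at \<open>\<Phi> (u, 1)\<close>, slowed down by
  \<open>\<sigma>\<close>. While that path rests at \<open>\<Phi> (u, 1) k\<close>, the new one runs
  back along \<open>\<Phi>\<close> to \<open>u k\<close>, reached exactly at the node, and forth
  again. It stays in one fiber since \<open>\<Phi>\<close> preserves fibers.\<close>

lemma planner_domain_preimage:
  fixes r :: nat and E :: "'e topology" and p :: "'e \<Rightarrow> 'x"
    and \<Phi> :: "(nat \<Rightarrow> 'e) \<times> real \<Rightarrow> (nat \<Rightarrow> 'e)"
  defines "Y \<equiv> fiber_power r E p"
  assumes r: "r \<ge> 2"
    and \<Phi>: "continuous_map (prod_topology Y unit_interval) Y \<Phi>"
    and \<Phi>_0: "\<And>u. u \<in> topspace Y \<Longrightarrow> \<Phi> (u, 0) = u"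
    and \<Phi>_fiber: "\<And>u t. u \<in> topspace Y \<Longrightarrow> t \<in> {0..1} \<Longrightarrow>
           fiber_power_proj p (\<Phi> (u, t)) = fiber_power_proj p u"
    and U: "planner_domain r E p U"
  shows "planner_domain r E p {u \<in> topspace Y. \<Phi> (u, 1) \<in> U}" (is "planner_domain r E p ?V")
proof -
  obtain s where s: "seq_motion_planner r E p U s"
      "continuous_map (subtopology Y U) (vertical_paths E p) s" and opU: "openin Y U"
    using U by (auto simp: planner_domain_def Y_def)
  have sU: "continuous_map unit_interval E (s v)" "\<And>t. t \<in> {0..1} \<Longrightarrow> p (s v t) = p (s v 0)"
      "\<And>k. k \<in> {1..r} \<Longrightarrow> s v ((real k - 1) / (real r - 1)) = v k" if "v \<in> U" for v
  proof -
    have "s v \<in> topspace (vertical_paths E p)" and ev: "path_eval r (s v) = v"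
      using s(1) that by (auto simp: seq_motion_planner_def)
    then show "continuous_map unit_interval E (s v)" "\<And>t. t \<in> {0..1} \<Longrightarrow> p (s v t) = p (s v 0)"
      unfolding vertical_paths_def topspace_subtopology topspace_compact_open_topology by blast+
    show "s v ((real k - 1) / (real r - 1)) = v k" if "k \<in> {1..r}" for k
      using fun_cong[OF ev, of k] that by (simp add: path_eval_def)
  qed
  have \<Phi>Y: "\<Phi> (u, t) \<in> topspace Y" if "u \<in> topspace Y" "t \<in> {0..1}" for u t
    using \<Phi> that by (auto simp: continuous_map_def)
  \<comment> \<open>The assumption concerns coordinate 1 only; in a fiber power all coordinates lie
    over the same point.\<close>
  have \<Phi>_proj: "p (\<Phi> (u, t) k) = p (u 1)" if "u \<in> topspace Y" "t \<in> {0..1}" "k \<in> {1..r}" for u t k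
  proof -
    have "p (\<Phi> (u, t) k) = p (\<Phi> (u, t) 1)"
    proof -
      have "\<forall>i\<in>{1..r}. \<forall>j\<in>{1..r}. p (\<Phi> (u, t) i) = p (\<Phi> (u, t) j)"
        using \<Phi>Y[OF that(1,2)] unfolding Y_def fiber_power_def topspace_subtopology by blast
      moreover have "1 \<in> {1..r}"
        using r by simp
      ultimately show ?thesis
        using that(3) by blast
    qed
    then show ?thesis
      using \<Phi>_fiber[OF that(1,2)] by (simp add: fiber_power_proj_def)
  qed
  have \<Phi>_1: "continuous_map Y Y (\<lambda>u. \<Phi> (u, 1))"
    using continuous_map_compose[OF continuous_map_pairedI \<Phi>, of Y "\<lambda>u. u" "\<lambda>_. 1"]
    by (simp add: o_def)
  have opV: "openin Y ?V"
    using \<Phi>_1 opU by (rule openin_continuous_map_preimage)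
  obtain \<sigma> where \<sigma>: "continuous_on {0..1} \<sigma>" "\<sigma> ` {0..1} \<subseteq> {0..1::real}"
    "\<forall>k\<in>{1..r}. \<forall>t. \<bar>(real r - 1) * t - (real k - 1)\<bar> \<le> 1/3 \<longrightarrow>
       \<sigma> t = (real k - 1) / (real r - 1)"
    using step_reparametrization[OF r] .
  define Z where "Z = subtopology Y ?V"
  define P where "P = prod_topology Z unit_interval"
  define d where "d k t = \<bar>(real r - 1) * t - (real k - 1)\<bar>" for k :: nat and t
  \<comment> \<open>Near the \<open>k\<close>-th node the path runs along \<open>\<Phi>\<close> between \<open>u k\<close> and \<open>\<Phi> (u, 1) k\<close>; piece \<open>0\<close> is the
    rest of the interval, where it follows the given planner at \<open>\<Phi> (u, 1)\<close>.\<close>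
  define T where "T k = (if k = 0 then {x \<in> topspace P. \<forall>k\<in>{1..r}. 1/3 \<le> d k (snd x)}
    else {x \<in> topspace P. d k (snd x) \<le> 1/3})" for k
  define f where "f k x = (if k = 0 then s (\<Phi> (fst x, 1)) (\<sigma> (snd x))
    else \<Phi> (fst x, min 1 (3 * d k (snd x))) k)" for k x
  have topP: "topspace P = ?V \<times> {0..1}"
    by (auto simp: P_def Z_def)
  have contZ: "continuous_map P Y fst"
    unfolding P_def Z_def by (rule continuous_map_into_fulltopology[OF continuous_map_fst])
  have contI: "continuous_map P unit_interval snd"
    unfolding P_def by (rule continuous_map_snd)
  have contd: "continuous_map P euclideanreal (\<lambda>x. d k (snd x))" for k
  proof -
    have "continuous_map unit_interval euclideanreal (d k)"
      unfolding d_def by (auto intro!: continuous_intros)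
    from continuous_map_compose[OF contI this] show ?thesis
      by (simp add: o_def)
  qed
  have "continuous_map P E (f k)" if "k \<in> {0..r}" for k
  proof (cases "k = 0")
    case True
    have "continuous_map P (subtopology Y U) (\<lambda>x. \<Phi> (fst x, 1))"
      using continuous_map_compose[OF contZ \<Phi>_1]
      by (intro continuous_map_into_subtopology) (auto simp: topP o_def)
    from continuous_map_compose[OF this s(2)]
    have "continuous_map P (compact_open_topology unit_interval E) (\<lambda>x. s (\<Phi> (fst x, 1)))"
      unfolding vertical_paths_def o_def by (rule continuous_map_into_fulltopology)
    moreover have "continuous_map P unit_interval (\<lambda>x. \<sigma> (snd x))"
      using continuous_map_compose[OF contI, of unit_interval \<sigma>] \<sigma>(1,2)
      by (simp add: o_def continuous_map_in_subtopology image_subset_iff_funcset)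
    ultimately have "continuous_map P E ((\<lambda>(\<gamma>, t). \<gamma> t) \<circ> (\<lambda>x. (s (\<Phi> (fst x, 1)), \<sigma> (snd x))))"
      by (intro continuous_map_compose[OF _ continuous_map_path_evaluation] continuous_map_pairedI)
    then show ?thesis
      using True by (simp add: f_def[abs_def] o_def)
  next
    case False
    \<comment> \<open>Truncating at 1 keeps the time in the unit interval also outside
      \<open>T k\<close>, so \<open>f k\<close> is continuous on all of \<open>P\<close>.\<close>
    have "continuous_map P unit_interval (\<lambda>x. min 1 (3 * d k (snd x)))"
      by (intro continuous_map_into_subtopology continuous_map_real_min continuous_map_real_mult_left
          contd continuous_map_const[THEN iffD2]) (auto simp: d_def)
    then have "continuous_map P Y (\<Phi> \<circ> (\<lambda>x. (fst x, min 1 (3 * d k (snd x)))))"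
      by (intro continuous_map_compose[OF _ \<Phi>] continuous_map_pairedI contZ)
    moreover have "continuous_map Y E (\<lambda>u. u k)"
      unfolding Y_def fiber_power_def using that False
      by (intro continuous_map_from_subtopology continuous_map_product_projection) auto
    ultimately have "continuous_map P E ((\<lambda>u. u k) \<circ> (\<Phi> \<circ> (\<lambda>x. (fst x, min 1 (3 * d k (snd x))))))"
      by (rule continuous_map_compose)
    then show ?thesis
      using False by (simp add: f_def[abs_def] o_def)
  qed
  then have contf: "continuous_map (subtopology P (T k)) E (f k)" if "k \<in> {0..r}" for k
    using that continuous_map_from_subtopology by blast
  have closed: "closedin P (T k)" if "k \<in> {0..r}" for k
  proof (cases "k = 0")
    case True
    have "1 \<in> {1..r}"
      using r by simp
    have "closedin P {x \<in> topspace P. d k (snd x) \<in> {1/3..}}" for k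
      using contd by (rule closedin_continuous_map_preimage) auto
    then have "closedin P (\<Inter>k\<in>{1..r}. {x \<in> topspace P. d k (snd x) \<in> {1/3..}})"
      using r by (intro closedin_INT) auto
    also have "(\<Inter>k\<in>{1..r}. {x \<in> topspace P. d k (snd x) \<in> {1/3..}}) = T k"
      using True \<open>1 \<in> {1..r}\<close> unfolding T_def by auto
    finally show ?thesis .
  next
    case False
    have "closedin P {x \<in> topspace P. d k (snd x) \<in> {..1/3}}"
      using contd by (rule closedin_continuous_map_preimage) auto
    then show ?thesis
      using False by (simp add: T_def)
  qed
  \<comment> \<open>On the common boundary \<open>d k\<close> is \<open>1/3\<close>: the excursion
    is at time 1, at \<open>\<Phi> (u, 1) k\<close>, where the planner rests at its
    \<open>k\<close>-th node.\<close>
  have agree_0: "f k x = f 0 x" if "k \<in> {1..r}" "x \<in> T k" "x \<in> T 0" for k x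
  proof -
    have x: "x \<in> topspace P" and "d k (snd x) \<le> 1/3" "1/3 \<le> d k (snd x)"
      using that by (auto simp: T_def)
    then have "d k (snd x) = 1/3"
      by simp
    moreover from this have "\<sigma> (snd x) = (real k - 1) / (real r - 1)"
      using \<sigma>(3) that(1) by (simp add: d_def)
    ultimately show ?thesis
      using that sU(3)[of "\<Phi> (fst x, 1)" k] x by (auto simp: f_def topP)
  qed
  have agree: "f i x = f j x" if "i \<in> {0..r}" "j \<in> {0..r}" "x \<in> topspace P \<inter> T i \<inter> T j" for i j x
  proof (cases "i = j \<or> i = 0 \<or> j = 0")
    case True
    then show ?thesis
      using that agree_0[of i x] agree_0[of j x] by (cases "i = 0"; cases "j = 0") auto
  next
    case False
    \<comment> \<open>In the rescaled time nodes are at distance at least 1, so windows of radius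
      \<open>1/3\<close> about different nodes are disjoint.\<close>
    then have "\<bar>real i - real j\<bar> \<ge> 1"
      by linarith
    moreover have "d i (snd x) \<le> 1/3" "d j (snd x) \<le> 1/3"
      using that False by (auto simp: T_def)
    ultimately show ?thesis
      unfolding d_def by linarith
  qed
  have cover: "topspace P \<subseteq> \<Union>(T ` {0..r})"
  proof
    fix x assume x: "x \<in> topspace P"
    show "x \<in> \<Union>(T ` {0..r})"
    proof (cases "\<forall>k\<in>{1..r}. 1/3 \<le> d k (snd x)")
      case True
      then show ?thesis
        using x by (auto simp: T_def intro!: bexI[of _ 0])
    next
      case False
      then obtain k where "k \<in> {1..r}" "d k (snd x) \<le> 1/3"
        by force
      then show ?thesis
        using x by (auto simp: T_def intro!: bexI[of _ k])
    qed
  qed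
  obtain g where g: "continuous_map P E g"
    and gf: "\<And>x k. k \<in> {0..r} \<Longrightarrow> x \<in> topspace P \<inter> T k \<Longrightarrow> g x = f k x"
    using pasting_lemma_exists_closed[OF _ cover closed contf agree] by blast
  have vertical: "p (g (u, t)) = p (u 1)" if ut: "u \<in> ?V" "t \<in> {0..1}" for u t
  proof -
    have x: "(u, t) \<in> topspace P"
      using that by (simp add: topP)
    then obtain k where k: "k \<in> {0..r}" "(u, t) \<in> T k"
      using cover by blast
    have "p (f k (u, t)) = p (u 1)"
    proof (cases "k = 0")
      case True
      have "s (\<Phi> (u, 1)) 0 = \<Phi> (u, 1) 1"
        using sU(3)[of "\<Phi> (u, 1)" 1] ut r by simp
      moreover have "\<sigma> t \<in> {0..1}"
        using \<sigma>(2) ut by blast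
      ultimately show ?thesis
        using True ut r sU(2)[of "\<Phi> (u, 1)" "\<sigma> t"] \<Phi>_proj[of u 1 1] by (simp add: f_def)
    next
      case False
      then show ?thesis
        using k ut \<Phi>_proj[of u "min 1 (3 * d k t)" k] by (simp add: f_def d_def)
    qed
    then show ?thesis
      using gf[OF k(1)] x k(2) by simp
  qed
  have nodes: "g (u, (real k - 1) / (real r - 1)) = u k" if "u \<in> ?V" "k \<in> {1..r}" for u k
  proof -
    let ?x = "(u, (real k - 1) / (real r - 1))"
    have "d k (snd ?x) = 0"
      using r by (simp add: d_def)
    moreover from this have "?x \<in> topspace P \<inter> T k"
      using that r by (auto simp: topP T_def)
    ultimately show ?thesis
      using gf[of k ?x] that \<Phi>_0 by (simp add: f_def)
  qed
  \<comment> \<open>Currying turns joint continuity of \<open>g\<close> into continuity for the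
    compact-open topology.\<close>
  define s' where "s' u = (\<lambda>t\<in>{0..1}. g (u, t))" for u
  have s': "continuous_map Z (compact_open_topology unit_interval E) s'"
    using continuous_map_curry[OF g[unfolded P_def]] by (simp add: s'_def[abs_def])
  have "continuous_map Z (vertical_paths E p) s'"
    unfolding vertical_paths_def
    by (rule continuous_map_into_subtopology[OF s']) (use vertical in \<open>auto simp: s'_def Z_def\<close>)
  moreover have "seq_motion_planner r E p ?V s'"
    unfolding seq_motion_planner_def
  proof (intro ballI conjI)
    fix u assume u: "u \<in> ?V"
    then show "s' u \<in> topspace (vertical_paths E p)"
      using calculation by (auto simp: continuous_map_def Z_def)
    have "u \<in> extensional {1..r}"
      using u by (auto simp: Y_def fiber_power_def PiE_def)
    moreover have "(real k - 1) / (real r - 1) \<in> {0..1}" if "k \<in> {1..r}" for k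
      using that r by simp
    ultimately show "path_eval r (s' u) = u"
      unfolding path_eval_def s'_def using nodes[OF u]
      by (intro extensionalityI[of _ "{1..r}"]) auto
  qed
  ultimately show ?thesis
    using opV unfolding planner_domain_def Z_def Y_def by blast
qed

text \<open>Pulling back each member of an optimal cover of \<open>A\<close> gives equally many
  planner domains covering the preimage.\<close>

lemma seq_TC_preimage:
  fixes \<Phi> :: "(nat \<Rightarrow> 'e) \<times> real \<Rightarrow> (nat \<Rightarrow> 'e)" and r :: nat
  assumes "r \<ge> 2"
    and "continuous_map (prod_topology (fiber_power r E p) unit_interval) (fiber_power r E p) \<Phi>"
    and "\<And>u. u \<in> topspace (fiber_power r E p) \<Longrightarrow> \<Phi> (u, 0) = u"
    and "\<And>u t. u \<in> topspace (fiber_power r E p) \<Longrightarrow> t \<in> {0..1} \<Longrightarrow>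
           fiber_power_proj p (\<Phi> (u, t)) = fiber_power_proj p u"
  shows "seq_TC r E p {u \<in> topspace (fiber_power r E p). \<Phi> (u, 1) \<in> A} \<le> seq_TC r E p A"
proof (cases "seq_TC r E p A")
  case (enat n)
  obtain U where U: "A \<subseteq> (\<Union>i\<in>{1..n}. U i)" "\<And>i. i \<in> {1..n} \<Longrightarrow> planner_domain r E p (U i)"
    using seq_TC_cover[OF enat] by metis
  show ?thesis
    unfolding enat
  proof (rule seq_TC_le)
    show "planner_domain r E p {u \<in> topspace (fiber_power r E p). \<Phi> (u, 1) \<in> U i}"
      if "i \<in> {1..n}" for i
      using assms U(2)[OF that] by (rule planner_domain_preimage)
  qed (use U(1) in blast)
qed simp

section \<open>The estimate for sequential parametrized complexity\<close>

theorem theorem5p13: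
  fixes r :: nat
    and E :: "'e topology" and X :: "'x topology" and p :: "'e \<Rightarrow> 'x"
    and \<Phi> :: "(nat \<Rightarrow> 'e) \<times> real \<Rightarrow> (nat \<Rightarrow> 'e)"
    and F :: "(nat \<Rightarrow> 'e) \<Rightarrow> real"
  assumes "r \<ge> 2"
    and "ANR_space E" and "ANR_space X"
    and "fibration E X p" and "path_connected_fibers E X p"
    and "continuous_map (prod_topology (fiber_power r E p) unit_interval) (fiber_power r E p) \<Phi>"
    and "\<And>u. u \<in> topspace (fiber_power r E p) \<Longrightarrow> \<Phi> (u, 0) = u"
    and "\<And>u t. u \<in> topspace (fiber_power r E p) \<Longrightarrow> t \<in> {0..1} \<Longrightarrow>
           fiber_power_proj p (\<Phi> (u, t)) = fiber_power_proj p u"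
    and "lyapunov_function (fiber_power r E p) (\<lambda>u. \<Phi> (u, 1)) F"
    and "bdd_below (F ` topspace (fiber_power r E p))"
    and "condition_D (fiber_power r E p) (\<lambda>u. \<Phi> (u, 1)) F"
  shows "\<forall>c::real.
           seq_TC r E p (sublevel (fiber_power r E p) F c)
             \<le> (\<Sum>\<^sub>\<infinity>\<mu>\<in>{..c}. seq_TC r E p
                  (level (fiber_power r E p) F \<mu> \<inter>
                   fixed_points (fiber_power r E p) (\<lambda>u. \<Phi> (u, 1))))"
proof
  fix c :: real
  interpret lusternik_schnirelmann "fiber_power r E p" "\<lambda>u. \<Phi> (u, 1)" F "seq_TC r E p"
  proof
    show "continuous_map (fiber_power r E p) (fiber_power r E p) (\<lambda>u. \<Phi> (u, 1))"
      using continuous_map_compose[OF continuous_map_pairedI assms(6),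
          of "fiber_power r E p" "\<lambda>u. u" "\<lambda>_. 1"]
      by (simp add: o_def)
    show "seq_TC r E p {u \<in> topspace (fiber_power r E p). \<Phi> (u, 1) \<in> A} \<le> seq_TC r E p A" for A
      using assms(1,6-8) by (rule seq_TC_preimage)
    show "\<exists>U. openin (fiber_power r E p) U \<and> A \<subseteq> U \<and> seq_TC r E p U \<le> seq_TC r E p A"
      if "A \<subseteq> topspace (fiber_power r E p)" for A
      using seq_TC_neighbourhood[OF that] by metis
  qed (rule assms(9-11) seq_TC_eq_0_iff seq_TC_Un | erule seq_TC_mono)+
  show "seq_TC r E p (sublevel (fiber_power r E p) F c)
      \<le> (\<Sum>\<^sub>\<infinity>\<mu>\<in>{..c}. seq_TC r E p
           (level (fiber_power r E p) F \<mu> \<inter> fixed_points (fiber_power r E p) (\<lambda>u. \<Phi> (u, 1))))"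
    by (rule index_sublevel_le_infsum)
qed

end
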